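(* The map $T:\Sigma\to\Sigma_1\times\Lambda$, which assigns $a+\alpha\mapsto\left(\frac1\alpha(a+\alpha),\alpha\right)$ (where $a\in\mathsf{HS}^h$, $\alpha\in\mathbb R_{>0}$), is bijective and isometric, where $\Sigma_1$ and $\Lambda$ have the induced submanifold metric. In other words, there is a Riemannian isomorphism $\Sigma\simeq\Sigma_1\times\Lambda$.
   Context: Let $H$ be a complex, infinite dimensional, separable Hilbert space, $\mathsf{HS}$ the Hilbert-Schmidt operators on $H$, $\mathsf{HS}^h$ the self-adjoint ones, and $\mathcal H_{\mathbb R}=\{a+\lambda:a\in\mathsf{HS}^h,\lambda\in\mathbb R\}$, a real Hilbert space with $\langle a+\lambda,b+\beta\rangle_2=4\,\mathrm{tr}(ab^* )+\lambda\beta$. $\Sigma$ is the set of positive invertible operators in $\mathcal H_{\mathbb R}$, open in $\mathcal H_{\mathbb R}$, with $T_p\Sigma=\mathcal H_{\mathbb R}$ and Riemannian metric $\langle x,y\rangle_p=\langle xp^{-1},p^{-1}y\rangle_2$, i.e. $\|x\|_p=\|p^{-1/2}xp^{-1/2}\|_2$. $\Sigma_1=\{a+1\in\Sigma:a\in\mathsf{HS}^h\}$ and $\Lambda=\{\lambda1:\lambda\in\mathbb R_{>0}\}\subset\Sigma$. The product carries the product metric. *)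

theory Defs
  imports "HOL-Analysis.Analysis"
begin

section \<open>The Hilbert space\<close>

text \<open>
  The underlying real Hilbert space structure (norm, topology, bounded operators) is the library's;
  the complex inner product is linear in its first argument. Infinite-dimensionality says that no finite
  set spans over the complex numbers.
\<close>

class infinite_separable_hilbert = real_inner + complete_space +
  fixes scaleC :: "complex \<Rightarrow> 'a \<Rightarrow> 'a" (infixr "*\<^sub>C" 75)
    and cinner :: "'a \<Rightarrow> 'a \<Rightarrow> complex"
  assumes scaleC_add_right: "c *\<^sub>C (x + y) = c *\<^sub>C x + c *\<^sub>C y"
    and scaleC_add_left: "(c + d) *\<^sub>C x = c *\<^sub>C x + d *\<^sub>C x"
    and scaleC_scaleC: "c *\<^sub>C d *\<^sub>C x = (c * d) *\<^sub>C x"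
    and scaleR_scaleC: "r *\<^sub>R x = complex_of_real r *\<^sub>C x"
    and cinner_commute: "cinner x y = cnj (cinner y x)"
    and cinner_add_left: "cinner (x + y) z = cinner x z + cinner y z"
    and cinner_scaleC_left: "cinner (c *\<^sub>C x) y = c * cinner x y"
    and inner_cinner: "inner x y = Re (cinner x y)"
    and separable: "\<exists>D. countable D \<and> (\<forall>x. \<forall>\<epsilon>>0. \<exists>d\<in>D. dist d x < \<epsilon>)"
    and infinite_dimensional: "finite B \<Longrightarrow> \<exists>x. \<forall>k. x \<noteq> (\<Sum>b\<in>B. k b *\<^sub>C b)"

text \<open>In a Hilbert space the maximal orthonormal sets are exactly the orthonormal bases.\<close>

definition onb :: "'h::infinite_separable_hilbert set \<Rightarrow> bool" where
  "onb E \<longleftrightarrow> (\<forall>e\<in>E. \<forall>f\<in>E. cinner e f = (if e = f then 1 else 0))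
     \<and> (\<forall>x. (\<forall>e\<in>E. cinner x e = 0) \<longrightarrow> x = 0)"

definition some_onb :: "'h::infinite_separable_hilbert set" where
  "some_onb = (SOME E. onb E)"

lemma cinner_add_right:
  "cinner (x::'h::infinite_separable_hilbert) (y + z) = cinner x y + cinner x z"
  by (metis cinner_add_left cinner_commute complex_cnj_add)

lemma cinner_scaleC_right:
  "cinner (x::'h::infinite_separable_hilbert) (c *\<^sub>C y) = cnj c * cinner x y"
  by (metis cinner_scaleC_left cinner_commute complex_cnj_mult)

lemma cinner_zero_left [simp]: "cinner 0 (x::'h::infinite_separable_hilbert) = 0"
  using cinner_add_left[of 0 0 x] by simp

lemma cinner_zero_right [simp]: "cinner (x::'h::infinite_separable_hilbert) 0 = 0"
  using cinner_add_right[of x 0 0] by simp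

lemma cinner_scaleR_left:
  "cinner (r *\<^sub>R x) (y::'h::infinite_separable_hilbert) = of_real r * cinner x y"
  by (simp add: scaleR_scaleC cinner_scaleC_left)

lemma cinner_scaleR_right:
  "cinner x (r *\<^sub>R (y::'h::infinite_separable_hilbert)) = of_real r * cinner x y"
  by (simp add: scaleR_scaleC cinner_scaleC_right)

lemma cinner_minus_left:
  "cinner (- x) (y::'h::infinite_separable_hilbert) = - cinner x y"
  using cinner_scaleR_left[of "-1" x y] by simp

lemma cinner_minus_right:
  "cinner x (- (y::'h::infinite_separable_hilbert)) = - cinner x y"
  using cinner_scaleR_right[of x "-1" y] by simp

lemma cinner_diff_left:
  "cinner (x - z) (y::'h::infinite_separable_hilbert) = cinner x y - cinner z y"
  using cinner_add_left[of x "- z" y] by (simp add: cinner_minus_left)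

lemma cinner_diff_right:
  "cinner x ((y::'h::infinite_separable_hilbert) - z) = cinner x y - cinner x z"
  using cinner_add_right[of x y "- z"] by (simp add: cinner_minus_right)

lemma cinner_self: "cinner x (x::'h::infinite_separable_hilbert) = of_real ((norm x)\<^sup>2)"
proof -
  have "Im (cinner x x) = 0" using arg_cong[OF cinner_commute[of x x], of Im] by simp
  then show ?thesis
    by (simp add: complex_eq_iff power2_norm_eq_inner inner_cinner)
qed

lemma norm_scaleC: "norm (c *\<^sub>C (x::'h::infinite_separable_hilbert)) = cmod c * norm x"
proof -
  have "complex_of_real ((norm (c *\<^sub>C x))\<^sup>2) = cinner (c *\<^sub>C x) (c *\<^sub>C x)"
    by (simp add: cinner_self)
  also have "\<dots> = (c * cnj c) * cinner x x"
    by (simp add: cinner_scaleC_left cinner_scaleC_right)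
  also have "\<dots> = complex_of_real ((cmod c * norm x)\<^sup>2)"
    by (simp add: cinner_self complex_norm_square[symmetric] power_mult_distrib del: complex_mult_cnj)
  finally have "(norm (c *\<^sub>C x))\<^sup>2 = (cmod c * norm x)\<^sup>2" using of_real_eq_iff by blast
  then show ?thesis by (simp add: power2_eq_iff_nonneg)
qed

lemma cinner_bound:
  "cmod (cinner x (y::'h::infinite_separable_hilbert)) \<le> norm x * norm y"
proof (cases "cinner x y = 0")
  case False
  define c where "c = cnj (sgn (cinner x y))"
  have c: "cmod c = 1" using False by (simp add: c_def norm_sgn)
  have "cnj (sgn z) * z = of_real (cmod z)" for z
    by (cases "z = 0")
      (auto simp: sgn_eq complex_norm_square[symmetric] power2_eq_square mult.commute
         field_simps simp del: complex_mult_cnj)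
  then have "of_real (cmod (cinner x y)) = cinner (c *\<^sub>C x) y"
    by (simp add: c_def cinner_scaleC_left)
  then have "cmod (cinner x y) = inner (c *\<^sub>C x) y"
    by (metis Re_complex_of_real inner_cinner)
  also have "\<dots> \<le> norm (c *\<^sub>C x) * norm y" by (rule norm_cauchy_schwarz)
  finally show ?thesis by (simp add: norm_scaleC c)
qed auto

lemma ex_onb: "\<exists>E::'h::infinite_separable_hilbert set. onb E"
proof -
  define A where "A = {E::'h set. \<forall>e\<in>E. \<forall>f\<in>E. cinner e f = (if e = f then 1 else 0)}"
  have "\<exists>M\<in>A. \<forall>X\<in>A. M \<subseteq> X \<longrightarrow> X = M"
  proof (rule subset_Zorn_nonempty)
    show "A \<noteq> {}" by (auto simp: A_def)
    fix C assume "C \<noteq> {}" and C: "subset.chain A C"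
    then have sub: "C \<subseteq> A" and ch: "\<And>X Y. X \<in> C \<Longrightarrow> Y \<in> C \<Longrightarrow> X \<subseteq> Y \<or> Y \<subseteq> X"
      by (auto simp: subset_chain_def)
    have "cinner e f = (if e = f then 1 else 0)" if ef: "e \<in> \<Union>C" "f \<in> \<Union>C" for e f
    proof -
      obtain X Y where XY: "X \<in> C" "e \<in> X" "Y \<in> C" "f \<in> Y" using ef by blast
      then obtain Z where "Z \<in> C" "e \<in> Z" "f \<in> Z" using ch[of X Y] by blast
      then show ?thesis using sub by (auto simp: A_def)
    qed
    then show "\<Union>C \<in> A" unfolding A_def by blast
  qed
  then obtain M where M: "M \<in> A" and max: "\<And>X. X \<in> A \<Longrightarrow> M \<subseteq> X \<Longrightarrow> X = M" by blast
  have "x = 0" if x: "\<forall>e\<in>M. cinner x e = 0" for x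
  proof (rule ccontr)
    assume "x \<noteq> 0"
    define u where "u = (1 / norm x) *\<^sub>R x"
    have nu: "norm u = 1" using \<open>x \<noteq> 0\<close> by (simp add: u_def)
    then have u1: "cinner u u = 1" by (simp add: cinner_self)
    have u0: "cinner u e = 0" "cinner e u = 0" if "e \<in> M" for e
      using x that cinner_commute[of e u] by (simp_all add: u_def cinner_scaleR_left)
    have "insert u M \<in> A" using M u1 u0 by (auto simp: A_def)
    then have "u \<in> M" using max[of "insert u M"] by blast
    then show False using u0[of u] u1 by simp
  qed
  with M have "onb M" unfolding onb_def A_def by simp
  then show ?thesis ..
qed

lemma onb_some_onb: "onb (some_onb :: 'h::infinite_separable_hilbert set)"
  unfolding some_onb_def using ex_onb by (rule someI_ex)

lemma onb_total: "onb E \<Longrightarrow> (\<And>e. e \<in> E \<Longrightarrow> cinner x e = 0) \<Longrightarrow> x = 0"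
  by (simp add: onb_def)

lemma infinite_onb:
  assumes "onb (E :: 'h::infinite_separable_hilbert set)" shows "infinite E"
proof
  assume fin: "finite E"
  have csum: "cinner (sum g E) y = (\<Sum>e\<in>E. cinner (g e) y)" for g :: "'h \<Rightarrow> 'h" and y
    using fin by (induction E rule: finite_induct) (auto simp: cinner_add_left)
  have "\<exists>k. x = (\<Sum>e\<in>E. k e *\<^sub>C e)" for x
  proof -
    define z where "z = (\<Sum>e\<in>E. cinner x e *\<^sub>C e)"
    have "cinner (x - z) f = 0" if f: "f \<in> E" for f
    proof -
      have "cinner z f = (\<Sum>e\<in>E. cinner x e * cinner e f)"
        by (simp add: z_def csum cinner_scaleC_left)
      also have "\<dots> = (\<Sum>e\<in>E. if e = f then cinner x e else 0)"
        using assms f by (intro sum.cong) (auto simp: onb_def)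
      finally show ?thesis using fin f by (simp add: cinner_diff_left)
    qed
    then have "x - z = 0" using onb_total[OF assms] by blast
    then have "x = z" by simp
    then show ?thesis unfolding z_def by blast
  qed
  with infinite_dimensional[OF fin] show False by blast
qed

section \<open>Operators\<close>

text \<open>
  Bounded operators on the complex Hilbert space are the bounded real-linear maps that commute
  with complex scalars.
\<close>

definition clinear_op :: "('h::infinite_separable_hilbert \<Rightarrow>\<^sub>L 'h) \<Rightarrow> bool" where
  "clinear_op A \<longleftrightarrow> (\<forall>c x. A (c *\<^sub>C x) = c *\<^sub>C A x)"

definition selfadjoint :: "('h::infinite_separable_hilbert \<Rightarrow>\<^sub>L 'h) \<Rightarrow> bool" where
  "selfadjoint A \<longleftrightarrow> (\<forall>x y. cinner (A x) y = cinner x (A y))"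

definition positive_op :: "('h::infinite_separable_hilbert \<Rightarrow>\<^sub>L 'h) \<Rightarrow> bool" where
  "positive_op A \<longleftrightarrow> selfadjoint A \<and> (\<forall>x. 0 \<le> Re (cinner (A x) x))"

definition invertible_op :: "('h::infinite_separable_hilbert \<Rightarrow>\<^sub>L 'h) \<Rightarrow> bool" where
  "invertible_op A \<longleftrightarrow> (\<exists>B. A o\<^sub>L B = id_blinfun \<and> B o\<^sub>L A = id_blinfun)"

definition inv_op :: "('h::infinite_separable_hilbert \<Rightarrow>\<^sub>L 'h) \<Rightarrow> ('h \<Rightarrow>\<^sub>L 'h)" where
  "inv_op A = (THE B. A o\<^sub>L B = id_blinfun \<and> B o\<^sub>L A = id_blinfun)"

definition adj_op :: "('h::infinite_separable_hilbert \<Rightarrow>\<^sub>L 'h) \<Rightarrow> ('h \<Rightarrow>\<^sub>L 'h)" where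
  "adj_op A = (THE B. \<forall>x y. cinner (A x) y = cinner x (blinfun_apply B y))"

definition scalar_op :: "complex \<Rightarrow> ('h::infinite_separable_hilbert \<Rightarrow>\<^sub>L 'h)" where
  "scalar_op c = Blinfun (\<lambda>x. c *\<^sub>C x)"

text \<open>
  The sum below is the same for all orthonormal bases, so it does not matter whether one asks for
  convergence for some or for every basis. For the same reason the trace, which is only used for
  products of two Hilbert-Schmidt operators, may be computed in an arbitrarily chosen basis.
\<close>

definition HS :: "('h::infinite_separable_hilbert \<Rightarrow>\<^sub>L 'h) set" where
  "HS = {A. clinear_op A \<and> (\<forall>E. onb E \<longrightarrow> (\<lambda>e. (norm (A e))\<^sup>2) summable_on E)}"

definition HSh :: "('h::infinite_separable_hilbert \<Rightarrow>\<^sub>L 'h) set" where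
  "HSh = {A \<in> HS. selfadjoint A}"

definition op_trace :: "('h::infinite_separable_hilbert \<Rightarrow>\<^sub>L 'h) \<Rightarrow> complex" where
  "op_trace A = (\<Sum>\<^sub>\<infinity>e\<in>some_onb. cinner (A e) e)"

text \<open>
  For operators \<open>A = a + \<lambda>\<close> with \<open>a\<close> Hilbert-Schmidt and complex \<open>\<lambda>\<close>:
  the scalar \<open>\<lambda>\<close>, the summand \<open>a\<close>, and the inner product of the context extended to
  such operators, \<open>4 tr (a b\<^sup>*) + \<lambda> (cnj \<beta>)\<close>. The extension is needed because
  \<open>x p\<^sup>-\<^sup>1\<close> and \<open>p\<^sup>-\<^sup>1 y\<close> in the Riemannian metric are not selfadjoint.
\<close>

definition scalar_part :: "('h::infinite_separable_hilbert \<Rightarrow>\<^sub>L 'h) \<Rightarrow> complex" where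
  "scalar_part A = (THE c. A - scalar_op c \<in> HS)"

definition hs_part :: "('h::infinite_separable_hilbert \<Rightarrow>\<^sub>L 'h) \<Rightarrow> ('h \<Rightarrow>\<^sub>L 'h)" where
  "hs_part A = A - scalar_op (scalar_part A)"

definition ip2 :: "('h::infinite_separable_hilbert \<Rightarrow>\<^sub>L 'h) \<Rightarrow> ('h \<Rightarrow>\<^sub>L 'h) \<Rightarrow> complex" where
  "ip2 A B = 4 * op_trace (hs_part A o\<^sub>L adj_op (hs_part B)) + scalar_part A * cnj (scalar_part B)"

lemma scalar_op_apply [simp]: "blinfun_apply (scalar_op c) (x :: 'h::infinite_separable_hilbert) = c *\<^sub>C x"
proof -
  have "bounded_linear (\<lambda>x::'h. c *\<^sub>C x)"
    by (rule bounded_linear_intro[of _ "cmod c"])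
      (auto simp: scaleC_add_right scaleR_scaleC scaleC_scaleC norm_scaleC mult.commute)
  then show ?thesis by (simp add: scalar_op_def bounded_linear_Blinfun_apply)
qed

lemma scalar_op_diff:
  "scalar_op c - scalar_op d = (scalar_op (c - d) :: 'h::infinite_separable_hilbert \<Rightarrow>\<^sub>L 'h)"
proof (rule blinfun_eqI)
  fix x :: 'h
  have "(c - d) *\<^sub>C x + d *\<^sub>C x = c *\<^sub>C x" by (simp flip: scaleC_add_left)
  then show "blinfun_apply (scalar_op c - scalar_op d) x = blinfun_apply (scalar_op (c - d)) x"
    by (simp add: blinfun.diff_left algebra_simps)
qed

lemma scalar_op_of_real: "scalar_op (complex_of_real r) = r *\<^sub>R id_blinfun"
  by (rule blinfun_eqI) (simp add: blinfun.scaleR_left scaleR_scaleC)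

lemma HS_0: "0 \<in> HS"
  using norm_scaleC[of _ 0] by (auto simp: HS_def clinear_op_def)

lemma HS_scaleR: assumes "A \<in> HS" shows "r *\<^sub>R A \<in> HS"
  using assms by (auto simp: HS_def clinear_op_def blinfun.scaleR_left scaleR_scaleC scaleC_scaleC
     norm_scaleC power_mult_distrib mult.commute intro!: summable_on_cmult_right)

lemma HS_add: assumes A: "A \<in> HS" and B: "B \<in> HS" shows "A + B \<in> HS"
proof -
  have "(\<lambda>e. (norm ((A + B) e))\<^sup>2) summable_on E" if E: "onb E" for E
  proof (rule summable_on_comparison_test)
    show "(\<lambda>e. 2 * (norm (A e))\<^sup>2 + 2 * (norm (B e))\<^sup>2) summable_on E"
      using A B E by (intro summable_on_add summable_on_cmult_right) (auto simp: HS_def)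
    fix e
    have "(norm ((A + B) e))\<^sup>2 \<le> (norm (A e) + norm (B e))\<^sup>2"
      by (intro power_mono) (auto simp: blinfun.add_left norm_triangle_ineq)
    also have "\<dots> \<le> 2 * (norm (A e))\<^sup>2 + 2 * (norm (B e))\<^sup>2"
      using sum_squares_bound[of "norm (A e)" "norm (B e)"] by (simp add: power2_sum)
    finally show "(norm ((A + B) e))\<^sup>2 \<le> 2 * (norm (A e))\<^sup>2 + 2 * (norm (B e))\<^sup>2" .
  qed auto
  then show ?thesis using A B
    by (auto simp: HS_def clinear_op_def blinfun.add_left scaleC_add_right)
qed

lemma HS_diff: assumes "A \<in> HS" "B \<in> HS" shows "A - B \<in> HS"
  using HS_add[OF assms(1) HS_scaleR[OF assms(2), of "-1"]] by simp

lemma scalar_op_HS: assumes "scalar_op c \<in> (HS :: ('h::infinite_separable_hilbert \<Rightarrow>\<^sub>L 'h) set)"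
  shows "c = 0"
proof (rule ccontr)
  assume c: "c \<noteq> 0"
  obtain E :: "'h set" where E: "onb E" using ex_onb by blast
  have n: "norm e = 1" if "e \<in> E" for e
  proof -
    have "cinner e e = 1" using E that by (auto simp: onb_def)
    then have "(norm e)\<^sup>2 = 1" unfolding cinner_self using of_real_eq_1_iff by blast
    then show ?thesis using norm_ge_zero[of e] by (auto simp: power2_eq_1_iff)
  qed
  have "(\<lambda>e. (norm (scalar_op c e))\<^sup>2) summable_on E" using assms E by (auto simp: HS_def)
  then have "(\<lambda>e::'h. (cmod c)\<^sup>2) summable_on E"
    by (rule summable_on_cong[THEN iffD1, rotated]) (simp add: norm_scaleC n)
  then have "finite E"
    using infsum_diverge_constant[of E "(cmod c)\<^sup>2"] c infinite_onb[OF E] by auto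
  with infinite_onb[OF E] show False by blast
qed

lemma HSh_0: "0 \<in> HSh"
  by (simp add: HSh_def HS_0 selfadjoint_def)

lemma HSh_add: "A \<in> HSh \<Longrightarrow> B \<in> HSh \<Longrightarrow> A + B \<in> HSh"
  by (auto simp: HSh_def HS_add selfadjoint_def blinfun.add_left cinner_add_left cinner_add_right)

lemma HSh_scaleR: "A \<in> HSh \<Longrightarrow> r *\<^sub>R A \<in> HSh"
  by (auto simp: HSh_def HS_scaleR selfadjoint_def blinfun.scaleR_left
     cinner_scaleR_left cinner_scaleR_right)

lemma scalar_part_eq:
  assumes "(a :: 'h::infinite_separable_hilbert \<Rightarrow>\<^sub>L 'h) \<in> HS"
  shows "scalar_part (a + scalar_op c) = c"
  unfolding scalar_part_def
proof (rule the_equality)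
  fix d assume "a + scalar_op c - scalar_op d \<in> HS"
  from HS_diff[OF this assms] have "scalar_op (c - d) \<in> (HS :: ('h \<Rightarrow>\<^sub>L 'h) set)"
    by (simp add: scalar_op_diff[symmetric] algebra_simps)
  then show "d = c" using scalar_op_HS by fastforce
qed (use assms in simp)

lemma hs_part_eq: assumes "a \<in> HS" shows "hs_part (a + scalar_op c) = a"
  by (simp add: hs_part_def scalar_part_eq[OF assms])

lemma adj_op_selfadjoint: assumes "selfadjoint A" shows "adj_op A = A"
  unfolding adj_op_def
proof (rule the_equality)
  show "\<forall>x y. cinner (A x) y = cinner x (A y)" using assms by (simp add: selfadjoint_def)
  fix B assume B: "\<forall>x y. cinner (A x) y = cinner x (blinfun_apply B y)"
  show "B = A"
  proof (rule blinfun_eqI)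
    fix y
    have "cinner x (B y - A y) = 0" for x
      using B assms by (simp add: cinner_diff_right selfadjoint_def)
    from this[of "B y - A y"] show "B y = A y" by (simp add: cinner_self)
  qed
qed

lemma op_trace_HSh: assumes "a \<in> HSh" "b \<in> HSh"
  shows "op_trace (a o\<^sub>L adj_op b) = (\<Sum>\<^sub>\<infinity>e\<in>some_onb. cinner (b e) (a e))"
    and "(\<lambda>e. cinner (b e) (a e)) summable_on some_onb"
proof -
  show "op_trace (a o\<^sub>L adj_op b) = (\<Sum>\<^sub>\<infinity>e\<in>some_onb. cinner (b e) (a e))"
    using assms adj_op_selfadjoint[of b] by (simp add: HSh_def op_trace_def selfadjoint_def)
  have "(\<lambda>e. (norm (b e))\<^sup>2 + (norm (a e))\<^sup>2) summable_on some_onb"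
    using assms by (intro summable_on_add) (auto simp: HSh_def HS_def onb_some_onb)
  then have "(\<lambda>e. cmod (cinner (b e) (a e))) summable_on some_onb"
  proof (rule summable_on_comparison_test)
    fix e
    have "cmod (cinner (b e) (a e)) \<le> norm (b e) * norm (a e)" by (rule cinner_bound)
    also have "\<dots> \<le> (norm (b e))\<^sup>2 + (norm (a e))\<^sup>2"
      using sum_squares_bound[of "norm (b e)" "norm (a e)"]
        mult_nonneg_nonneg[OF norm_ge_zero[of "b e"] norm_ge_zero[of "a e"]] by linarith
    finally show "cmod (cinner (b e) (a e)) \<le> (norm (b e))\<^sup>2 + (norm (a e))\<^sup>2" .
  qed auto
  then show "(\<lambda>e. cinner (b e) (a e)) summable_on some_onb" by (rule abs_summable_summable)
qed

lemma ip2_eq: assumes "a \<in> HSh" "b \<in> HSh"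
  shows "ip2 (a + scalar_op c) (b + scalar_op d) = 4 * op_trace (a o\<^sub>L adj_op b) + c * cnj d"
  using assms by (simp add: ip2_def scalar_part_eq hs_part_eq HSh_def)

section \<open>The real Hilbert space of selfadjoint operators \<open>a + \<lambda>\<close>\<close>

typedef (overloaded) 'h hr =
  "{A :: 'h::infinite_separable_hilbert \<Rightarrow>\<^sub>L 'h. \<exists>a\<in>HSh. \<exists>r::real. A = a + r *\<^sub>R id_blinfun}"
  morphisms op_of to_hr
  by (rule exI[of _ 0], rule CollectI, rule bexI[OF _ HSh_0], rule exI[of _ 0]) simp

lemma op_of_cases:
  obtains a r where "a \<in> HSh" "op_of x = a + scalar_op (complex_of_real r)"
  using op_of[of x] by (auto simp: scalar_op_of_real)

lemma op_of_to_hr: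
  "a \<in> HSh \<Longrightarrow> op_of (to_hr (a + r *\<^sub>R id_blinfun)) = a + r *\<^sub>R id_blinfun"
  by (rule to_hr_inverse) blast

text \<open>
  For selfadjoint Hilbert-Schmidt \<open>a\<close>, \<open>b\<close> the number \<open>tr (a b\<^sup>*) = tr (a b)\<close> is
  real, so \<open>Re\<close> only changes the type.
\<close>

instantiation hr :: (infinite_separable_hilbert) "{real_inner, one}"
begin

definition zero_hr :: "'a hr" where "0 = to_hr 0"
definition one_hr :: "'a hr" where "1 = to_hr id_blinfun"
definition plus_hr :: "'a hr \<Rightarrow> 'a hr \<Rightarrow> 'a hr" where "x + y = to_hr (op_of x + op_of y)"
definition minus_hr :: "'a hr \<Rightarrow> 'a hr \<Rightarrow> 'a hr" where "x - y = to_hr (op_of x - op_of y)"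
definition uminus_hr :: "'a hr \<Rightarrow> 'a hr" where "- x = to_hr (- op_of x)"
definition scaleR_hr :: "real \<Rightarrow> 'a hr \<Rightarrow> 'a hr" where "r *\<^sub>R x = to_hr (r *\<^sub>R op_of x)"
definition inner_hr :: "'a hr \<Rightarrow> 'a hr \<Rightarrow> real" where "inner x y = Re (ip2 (op_of x) (op_of y))"
definition norm_hr :: "'a hr \<Rightarrow> real" where "norm x = sqrt (inner x (x :: 'a hr))"
definition sgn_hr :: "'a hr \<Rightarrow> 'a hr" where "sgn (x :: 'a hr) = inverse (norm x) *\<^sub>R x"
definition dist_hr :: "'a hr \<Rightarrow> 'a hr \<Rightarrow> real" where "dist x y = norm (x - (y :: 'a hr))"
definition uniformity_hr :: "('a hr \<times> 'a hr) filter" where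
  "uniformity = (INF e\<in>{0<..}. principal {(x::'a hr, y). dist x y < e})"
definition open_hr :: "'a hr set \<Rightarrow> bool" where
  "open U \<longleftrightarrow> (\<forall>x\<in>U. \<forall>\<^sub>F (x', y) in uniformity. x' = x \<longrightarrow> y \<in> (U :: 'a hr set))"

lemma op_of_zero: "op_of (0::'a hr) = 0"
  using op_of_to_hr[OF HSh_0, of 0] by (simp add: zero_hr_def)

lemma op_of_one: "op_of (1::'a hr) = id_blinfun"
  using op_of_to_hr[OF HSh_0, of 1] by (simp add: one_hr_def)

lemma op_of_add: "op_of (x + y :: 'a hr) = op_of x + op_of y"
  unfolding plus_hr_def
proof (rule to_hr_inverse, rule op_of_cases[of x], rule op_of_cases[of y])
  fix a r b s assume "a \<in> HSh" "op_of x = a + scalar_op (complex_of_real r)"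
    and "b \<in> HSh" "op_of y = b + scalar_op (complex_of_real s)"
  then have "a + b \<in> HSh" "op_of x + op_of y = (a + b) + (r + s) *\<^sub>R id_blinfun"
    by (auto intro: HSh_add simp: scalar_op_of_real scaleR_add_left)
  then show "op_of x + op_of y \<in> {A. \<exists>a\<in>HSh. \<exists>r::real. A = a + r *\<^sub>R id_blinfun}" by blast
qed

lemma op_of_scaleR: "op_of (s *\<^sub>R x :: 'a hr) = s *\<^sub>R op_of x"
  unfolding scaleR_hr_def
proof (rule to_hr_inverse, rule op_of_cases[of x])
  fix a r assume "a \<in> HSh" "op_of x = a + scalar_op (complex_of_real r)"
  then have "s *\<^sub>R a \<in> HSh" "s *\<^sub>R op_of x = s *\<^sub>R a + (s * r) *\<^sub>R id_blinfun"
    by (auto intro: HSh_scaleR simp: scalar_op_of_real scaleR_add_right)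
  then show "s *\<^sub>R op_of x \<in> {A. \<exists>a\<in>HSh. \<exists>r::real. A = a + r *\<^sub>R id_blinfun}" by blast
qed

lemma op_of_uminus: "op_of (- x :: 'a hr) = - op_of x"
  using op_of_scaleR[of "-1" x] by (simp add: uminus_hr_def scaleR_hr_def)

lemma op_of_minus: "op_of (x - y :: 'a hr) = op_of x - op_of y"
  using op_of_add[of x "- y"] by (simp add: op_of_uminus) (simp add: minus_hr_def plus_hr_def op_of_uminus)

lemma inner_hr_eq:
  assumes "a \<in> HSh" "op_of x = a + scalar_op (complex_of_real r)"
    and "b \<in> HSh" "op_of y = b + scalar_op (complex_of_real s)"
  shows "inner (x::'a hr) y = 4 * (\<Sum>\<^sub>\<infinity>e\<in>some_onb. inner (b e) (a e)) + r * s"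
  using assms op_trace_HSh[OF assms(1,3)]
  by (simp add: inner_hr_def ip2_eq inner_cinner infsum_Re)

lemma inner_summable:
  assumes "a \<in> HSh" "b \<in> HSh"
  shows "(\<lambda>e. inner (b e) (a e)) summable_on (some_onb :: 'a set)"
  using summable_on_Re[OF op_trace_HSh(2)[OF assms]] by (simp add: inner_cinner)

instance
proof
  fix x y z :: "'a hr" and r s :: real
  show "x + y + z = x + (y + z)" "x + y = y + x" "0 + x = x" "- x + x = 0" "x - y = x + - y"
    "r *\<^sub>R (x + y) = r *\<^sub>R x + r *\<^sub>R y" "(r + s) *\<^sub>R x = r *\<^sub>R x + s *\<^sub>R x"
    "r *\<^sub>R s *\<^sub>R x = (r * s) *\<^sub>R x" "1 *\<^sub>R x = x"
    by (simp_all add: op_of_inject[symmetric] op_of_add op_of_zero op_of_uminus op_of_minus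
        op_of_scaleR algebra_simps)
  show "sgn x = inverse (norm x) *\<^sub>R x" by (rule sgn_hr_def)
  show "dist x y = norm (x - y)" by (rule dist_hr_def)
  show "uniformity = (INF e\<in>{0<..}. principal {(x::'a hr, y). dist x y < e})"
    by (rule uniformity_hr_def)
  show "open U = (\<forall>x\<in>U. \<forall>\<^sub>F (x', y) in uniformity. x' = x \<longrightarrow> y \<in> U)" for U :: "'a hr set"
    by (rule open_hr_def)
  show "norm x = sqrt (inner x x)" by (rule norm_hr_def)
  obtain a p where a: "a \<in> HSh" "op_of x = a + scalar_op (complex_of_real p)"
    by (rule op_of_cases)
  obtain b q where b: "b \<in> HSh" "op_of y = b + scalar_op (complex_of_real q)"
    by (rule op_of_cases)
  obtain c t where c: "c \<in> HSh" "op_of z = c + scalar_op (complex_of_real t)"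
    by (rule op_of_cases)
  show "inner x y = inner y x"
    by (simp add: inner_hr_eq[OF a b] inner_hr_eq[OF b a] inner_commute mult.commute)
  have ab: "op_of (x + y) = (a + b) + scalar_op (complex_of_real (p + q))"
    using a b by (simp add: op_of_add scalar_op_of_real scaleR_add_left del: of_real_add)
  show "inner (x + y) z = inner x z + inner y z"
    by (simp add: inner_hr_eq[OF HSh_add[OF a(1) b(1)] ab c] inner_hr_eq[OF a c] inner_hr_eq[OF b c]
        blinfun.add_left inner_add_right infsum_add inner_summable a b c algebra_simps)
  have ra: "op_of (r *\<^sub>R x) = r *\<^sub>R a + scalar_op (complex_of_real (r * p))"
    using a by (simp add: op_of_scaleR scalar_op_of_real scaleR_add_right del: of_real_mult)
  show "inner (r *\<^sub>R x) y = r * inner x y"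
    by (simp add: inner_hr_eq[OF HSh_scaleR[OF a(1)] ra b] inner_hr_eq[OF a b]
        blinfun.scaleR_left infsum_cmult_right' algebra_simps)
  have pos: "0 \<le> (\<Sum>\<^sub>\<infinity>e\<in>some_onb. inner (a e) (a e))" by (rule infsum_nonneg) simp
  then show "0 \<le> inner x x" by (simp add: inner_hr_eq[OF a a])
  show "inner x x = 0 \<longleftrightarrow> x = 0"
  proof
    assume "inner x x = 0"
    then have z: "(\<Sum>\<^sub>\<infinity>e\<in>some_onb. inner (a e) (a e)) = 0" "p * p = 0"
      using pos zero_le_square[of p] unfolding inner_hr_eq[OF a a] by linarith+
    have "a e = 0" if "e \<in> some_onb" for e
      using nonneg_infsum_le_0D[OF _ inner_summable[OF a(1) a(1)] _ that] z by simp
    then have "cinner (a v) e = 0" if "e \<in> some_onb" for v e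
      using a that by (simp add: HSh_def selfadjoint_def)
    then have "a v = 0" for v using onb_total[OF onb_some_onb] by blast
    then have "a = 0" by (intro blinfun_eqI) simp
    then show "x = 0" using a z
      by (simp add: op_of_inject[symmetric] op_of_zero scalar_op_of_real[of 0, simplified])
  next
    assume "x = 0"
    then have "op_of x = 0 + scalar_op (complex_of_real 0)"
      by (simp add: op_of_zero scalar_op_of_real[of 0, simplified])
    from inner_hr_eq[OF HSh_0 this HSh_0 this] show "inner x x = 0" by simp
  qed
qed

end

text \<open>\<open>scal\<close> is the scalar \<open>\<lambda>\<close> of \<open>a + \<lambda>\<close>.\<close>

definition scal :: "'h::infinite_separable_hilbert hr \<Rightarrow> real" where
  "scal x = Re (scalar_part (op_of x))"

lemma scal_eq: "a \<in> HSh \<Longrightarrow> scal (to_hr (a + r *\<^sub>R id_blinfun)) = r"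
  using scalar_part_eq[of a "complex_of_real r"]
  by (simp add: scal_def op_of_to_hr HSh_def scalar_op_of_real)

lemma inner_hr:
  assumes "a \<in> HSh" "b \<in> HSh"
  shows "inner (to_hr (a + r *\<^sub>R id_blinfun)) (to_hr (b + s *\<^sub>R id_blinfun))
       = 4 * Re (op_trace (a o\<^sub>L adj_op b)) + r * s"
  using ip2_eq[OF assms, of "complex_of_real r" "complex_of_real s"] assms
  by (simp add: inner_hr_def op_of_to_hr scalar_op_of_real)

section \<open>Smooth maps and Riemannian isomorphisms\<close>

text \<open>Bounded \<open>n\<close>-linear maps, as functions on argument lists of length \<open>n\<close>.\<close>

definition bounded_multilinear ::
  "nat \<Rightarrow> ('a::real_normed_vector list \<Rightarrow> 'b::real_normed_vector) \<Rightarrow> bool" where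
  "bounded_multilinear n M \<longleftrightarrow>
     (\<forall>us v w r ws. length us + length ws + 1 = n \<longrightarrow>
        M (us @ (v + r *\<^sub>R w) # ws) = M (us @ v # ws) + r *\<^sub>R M (us @ w # ws))
   \<and> (\<exists>B. \<forall>vs. length vs = n \<longrightarrow> norm (M vs) \<le> B * prod_list (map norm vs))"

text \<open>
  \<open>D n x\<close> is the \<open>n\<close>-th Frechet derivative of \<open>f\<close> at \<open>x\<close>, a bounded
  \<open>n\<close>-linear map: the last clause says that \<open>D n\<close> is Frechet differentiable in operator
  norm with derivative \<open>D (Suc n)\<close>. A family indexed by \<open>n\<close> is used because iterating the
  derivative into bounded linear functions changes the type at each step.
\<close>

definition smooth_on :: "'a::real_normed_vector set \<Rightarrow> ('a \<Rightarrow> 'b::real_normed_vector) \<Rightarrow> bool" where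
  "smooth_on U f \<longleftrightarrow> open U \<and>
     (\<exists>D :: nat \<Rightarrow> 'a \<Rightarrow> 'a list \<Rightarrow> 'b.
        (\<forall>x\<in>U. D 0 x [] = f x)
      \<and> (\<forall>n. \<forall>x\<in>U. bounded_multilinear n (D n x))
      \<and> (\<forall>n. \<forall>x\<in>U. \<forall>\<epsilon>>0. \<exists>\<delta>>0. \<forall>y\<in>U. norm (y - x) < \<delta> \<longrightarrow>
           (\<forall>vs. length vs = n \<longrightarrow>
              norm (D n y vs - D n x vs - D (Suc n) x ((y - x) # vs))
                \<le> \<epsilon> * norm (y - x) * prod_list (map norm vs))))"

text \<open>Smoothness on a submanifold of a normed space: locally the restriction of a smooth map.\<close>

definition smooth_map :: "'a::real_normed_vector set \<Rightarrow> ('a \<Rightarrow> 'b::real_normed_vector) \<Rightarrow> bool" where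
  "smooth_map M f \<longleftrightarrow>
     (\<forall>p\<in>M. \<exists>U F. p \<in> U \<and> smooth_on U F \<and> (\<forall>x\<in>U \<inter> M. F x = f x))"

text \<open>
  \<open>M\<close> and \<open>N\<close> are submanifolds of normed spaces with tangent spaces \<open>TM\<close>, \<open>TN\<close>
  and Riemannian metrics \<open>g\<close>, \<open>h\<close>. A derivative of \<open>f\<close> within \<open>M\<close> is
  determined on the tangent space, which is the only place where it is used.
\<close>

definition riemannian_isomorphism ::
  "'a::real_normed_vector set \<Rightarrow> ('a \<Rightarrow> 'a set) \<Rightarrow> ('a \<Rightarrow> 'a \<Rightarrow> 'a \<Rightarrow> real) \<Rightarrow>
   'b::real_normed_vector set \<Rightarrow> ('b \<Rightarrow> 'b set) \<Rightarrow> ('b \<Rightarrow> 'b \<Rightarrow> 'b \<Rightarrow> real) \<Rightarrow>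
   ('a \<Rightarrow> 'b) \<Rightarrow> bool" where
  "riemannian_isomorphism M TM g N TN h f \<longleftrightarrow>
     bij_betw f M N \<and> smooth_map M f \<and> smooth_map N (inv_into M f) \<and>
     (\<forall>p\<in>M. \<exists>D. (f has_derivative D) (at p within M) \<and> bij_betw D (TM p) (TN (f p)) \<and>
        (\<forall>v\<in>TM p. \<forall>w\<in>TM p. h (f p) (D v) (D w) = g p v w))"

section \<open>The manifolds\<close>

definition Sigma_pos :: "'h::infinite_separable_hilbert hr set" where
  "Sigma_pos = {p. positive_op (op_of p) \<and> invertible_op (op_of p)}"

definition Sigma_one :: "'h::infinite_separable_hilbert hr set" where
  "Sigma_one = {p \<in> Sigma_pos. \<exists>a\<in>HSh. op_of p = a + id_blinfun}"

definition Lambda_pos :: "'h::infinite_separable_hilbert hr set" where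
  "Lambda_pos = {r *\<^sub>R 1 | r. r > 0}"

text \<open>The value of \<open>ip2\<close> is real here, since it involves \<open>tr (x p\<^sup>-\<^sup>1 y p\<^sup>-\<^sup>1)\<close>
  with selfadjoint \<open>x\<close>, \<open>y\<close>, \<open>p\<close>.\<close>

definition sigma_metric ::
  "'h::infinite_separable_hilbert hr \<Rightarrow> 'h hr \<Rightarrow> 'h hr \<Rightarrow> real" where
  "sigma_metric p x y =
     Re (ip2 (op_of x o\<^sub>L inv_op (op_of p)) (inv_op (op_of p) o\<^sub>L op_of y))"

definition product_metric ::
  "('a \<Rightarrow> 'a \<Rightarrow> 'a \<Rightarrow> real) \<Rightarrow> ('b \<Rightarrow> 'b \<Rightarrow> 'b \<Rightarrow> real) \<Rightarrow> 'a \<times> 'b \<Rightarrow> 'a \<times> 'b \<Rightarrow> 'a \<times> 'b \<Rightarrow> real" where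
  "product_metric g h p v w = g (fst p) (fst v) (fst w) + h (snd p) (snd v) (snd w)"

text \<open>\<open>Sigma_pos\<close> is open in the space of all \<open>a + \<lambda>\<close>, \<open>Sigma_one\<close> is open in an affine
  translate of the closed subspace of selfadjoint Hilbert-Schmidt operators, and
  \<open>Lambda_pos\<close> is an open ray of a line; the tangent spaces are accordingly constant.\<close>

definition tangent_Sigma :: "'h::infinite_separable_hilbert hr \<Rightarrow> 'h hr set" where
  "tangent_Sigma p = UNIV"

definition tangent_Sigma_one :: "'h::infinite_separable_hilbert hr \<Rightarrow> 'h hr set" where
  "tangent_Sigma_one p = {x. op_of x \<in> HSh}"

definition tangent_Lambda :: "'h::infinite_separable_hilbert hr \<Rightarrow> 'h hr set" where
  "tangent_Lambda p = range (\<lambda>r. r *\<^sub>R 1)"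

definition T_map :: "'h::infinite_separable_hilbert hr \<Rightarrow> 'h hr \<times> 'h hr" where
  "T_map p = ((1 / scal p) *\<^sub>R p, scal p *\<^sub>R 1)"

lemma T_map_eq:
  assumes "a \<in> HSh"
  shows "T_map (to_hr (a + \<alpha> *\<^sub>R id_blinfun))
       = (to_hr ((1 / \<alpha>) *\<^sub>R (a + \<alpha> *\<^sub>R id_blinfun)), to_hr (\<alpha> *\<^sub>R id_blinfun))"
  by (simp add: T_map_def scal_eq assms scaleR_hr_def op_of_to_hr op_of_one)

end

theory Submission
  imports Defs
begin

text \<open>
  Write \<open>P = a + \<lambda>\<close> for a point of \<open>Sigma_pos\<close>. Its scalar \<open>\<lambda>\<close> is \<open>inner P 1\<close>, hence a bounded linear
  functional of \<open>P\<close>, and it is positive: a Hilbert-Schmidt operator is arbitrarily small on some vector of an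
  orthonormal basis, whereas \<open>\<lambda> \<le> 0\<close> together with positivity and invertibility of \<open>P\<close> would bound
  \<open>norm (a e)\<close> away from \<open>0\<close> on all of them (\<open>scal_pos\<close>). So \<open>T\<close> is just rescaling to scalar \<open>1\<close>
  while recording the scalar, with inverse \<open>(q, l) \<mapsto> scal l *\<^sub>R q\<close>.

  Both directions are smooth because their components are linear or of the form \<open>g (\<phi> x) *\<^sub>R L x\<close> with linear
  \<open>\<phi>\<close> and \<open>L\<close> and with \<open>g t = 1 / t\<close> or \<open>g t = t\<close>; all derivatives of such a map can be written down
  (\<open>smooth_on_scaleR_functional\<close>).

  For the metric, let \<open>V = v + \<xi>\<close> be a tangent vector. From \<open>P\<^sup>-\<^sup>1 = (1 - P\<^sup>-\<^sup>1 a) / \<lambda>\<close> both \<open>V P\<^sup>-\<^sup>1\<close> and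
  \<open>P\<^sup>-\<^sup>1 V\<close> are \<open>\<xi> / \<lambda>\<close> plus a Hilbert-Schmidt operator (\<open>HS_minus_scalar_compose_inv\<close>). The derivative of
  \<open>T\<close> sends \<open>V\<close> to \<open>V / \<lambda> - \<xi> P / \<lambda>\<^sup>2\<close> and \<open>\<xi>\<close>; multiplying the first component by the inverse
  \<open>\<lambda> P\<^sup>-\<^sup>1\<close> of the new base point gives \<open>V P\<^sup>-\<^sup>1 - \<xi> / \<lambda>\<close>, which is exactly the Hilbert-Schmidt part of
  \<open>V P\<^sup>-\<^sup>1\<close>. So the first factor of the product carries the trace term of \<open>\<langle>V, W\<rangle>\<close> at \<open>P\<close>, and the second
  factor carries the product of the scalar parts. The two sides contain literally the same trace.
\<close>

section \<open>Smoothness\<close>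

text \<open>
  Singling out one order and one point of the family of derivatives lets maps be added order by order.
\<close>

definition multilinear_derivative ::
  "nat \<Rightarrow> 'a::real_normed_vector set \<Rightarrow> 'a \<Rightarrow> ('a \<Rightarrow> 'a list \<Rightarrow> 'b::real_normed_vector) \<Rightarrow>
    ('a list \<Rightarrow> 'b) \<Rightarrow> bool" where
  "multilinear_derivative n U x M M' \<longleftrightarrow>
     (\<forall>\<epsilon>>0. \<exists>\<delta>>0. \<forall>y\<in>U. norm (y - x) < \<delta> \<longrightarrow> (\<forall>vs. length vs = n \<longrightarrow>
        norm (M y vs - M x vs - M' ((y - x) # vs)) \<le> \<epsilon> * norm (y - x) * prod_list (map norm vs)))"

lemma smooth_on_iff:
  "smooth_on U f \<longleftrightarrow> open U \<and> (\<exists>D. (\<forall>x\<in>U. D 0 x [] = f x)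
      \<and> (\<forall>n. \<forall>x\<in>U. bounded_multilinear n (D n x))
      \<and> (\<forall>n. \<forall>x\<in>U. multilinear_derivative n U x (D n) (D (Suc n) x)))"
  unfolding smooth_on_def multilinear_derivative_def by (rule refl)

text \<open>
  On \<open>[v\<^sub>1, \<dots>, v\<^sub>n]\<close> this is the sum over \<open>i\<close> of \<open>L v\<^sub>i\<close> times the product of the \<open>\<phi> v\<^sub>j\<close> with
  \<open>j \<noteq> i\<close>: in the \<open>n\<close>-th derivative of \<open>g (\<phi> x) *\<^sub>R L x\<close> it collects the terms in which one direction
  differentiates the factor \<open>L x\<close>.
\<close>

fun leibniz_sum :: "('a \<Rightarrow> real) \<Rightarrow> ('a \<Rightarrow> 'b::real_normed_vector) \<Rightarrow> 'a list \<Rightarrow> 'b" where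
  "leibniz_sum \<phi> L [] = 0"
| "leibniz_sum \<phi> L (v # vs) = prod_list (map \<phi> vs) *\<^sub>R L v + \<phi> v *\<^sub>R leibniz_sum \<phi> L vs"

lemma leibniz_sum_append:
  "leibniz_sum \<phi> L (us @ vs) =
     prod_list (map \<phi> vs) *\<^sub>R leibniz_sum \<phi> L us + prod_list (map \<phi> us) *\<^sub>R leibniz_sum \<phi> L vs"
  by (induction us) (auto simp: algebra_simps)

lemma prod_list_map_bounded:
  assumes "bounded_linear \<phi>"
  shows "\<exists>C\<ge>0. \<forall>vs. length vs = n \<longrightarrow> \<bar>prod_list (map \<phi> vs)\<bar> \<le> C * prod_list (map norm vs)"
proof -
  obtain K where K: "K \<ge> 0" "\<And>x. norm (\<phi> x) \<le> norm x * K"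
    using bounded_linear.nonneg_bounded[OF assms] by blast
  have "\<bar>prod_list (map \<phi> vs)\<bar> \<le> K ^ length vs * prod_list (map norm vs)" for vs
  proof (induction vs)
    case (Cons v vs)
    have "\<bar>\<phi> v\<bar> * \<bar>prod_list (map \<phi> vs)\<bar> \<le> (norm v * K) * (K ^ length vs * prod_list (map norm vs))"
      using Cons K(1) K(2)[of v] by (intro mult_mono) auto
    then show ?case by (simp add: abs_mult algebra_simps)
  qed auto
  then show ?thesis using K(1) by (intro exI[of _ "K ^ n"]) auto
qed

lemma prod_list_norm_nonneg: "0 \<le> prod_list (map norm (vs :: 'a::real_normed_vector list))"
  by (induction vs) auto

lemma leibniz_sum_bounded:
  assumes \<phi>: "bounded_linear \<phi>" and L: "bounded_linear L"
  shows "\<exists>C\<ge>0. \<forall>vs. length vs = n \<longrightarrow> norm (leibniz_sum \<phi> L vs) \<le> C * prod_list (map norm vs)"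
proof (induction n)
  case 0
  then show ?case by (auto intro!: exI[of _ 0])
next
  case (Suc n)
  obtain C where C: "C \<ge> 0" "\<And>vs. length vs = n \<Longrightarrow> norm (leibniz_sum \<phi> L vs) \<le> C * prod_list (map norm vs)"
    using Suc by blast
  obtain K where K: "K \<ge> 0" "\<And>x. norm (\<phi> x) \<le> norm x * K"
    using bounded_linear.nonneg_bounded[OF \<phi>] by blast
  obtain M where M: "M \<ge> 0" "\<And>x. norm (L x) \<le> norm x * M"
    using bounded_linear.nonneg_bounded[OF L] by blast
  obtain P where P: "P \<ge> 0" "\<And>vs. length vs = n \<Longrightarrow> \<bar>prod_list (map \<phi> vs)\<bar> \<le> P * prod_list (map norm vs)"
    using prod_list_map_bounded[OF \<phi>, of n] by blast
  have "norm (leibniz_sum \<phi> L vs) \<le> (P * M + K * C) * prod_list (map norm vs)" if len: "length vs = Suc n" for vs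
  proof -
    obtain w ws where vs: "vs = w # ws" "length ws = n" using len by (cases vs) auto
    have "norm (leibniz_sum \<phi> L vs) \<le>
        \<bar>prod_list (map \<phi> ws)\<bar> * norm (L w) + \<bar>\<phi> w\<bar> * norm (leibniz_sum \<phi> L ws)"
      unfolding vs leibniz_sum.simps by (rule norm_triangle_le) simp
    also have "\<dots> \<le> (P * prod_list (map norm ws)) * (norm w * M)
        + (norm w * K) * (C * prod_list (map norm ws))"
      using C P M(2)[of w] K(2)[of w] vs K(1) M(1) prod_list_norm_nonneg[of ws]
      by (intro add_mono mult_mono) auto
    finally show ?thesis by (simp add: vs algebra_simps)
  qed
  then show ?case using C(1) P(1) K(1) M(1) by (intro exI[of _ "P * M + K * C"]) auto
qed

text \<open>
  Since \<open>\<phi>\<close> and \<open>L\<close> are linear, the Leibniz rule yields only two kinds of terms: all \<open>n\<close> directions hit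
  \<open>g (\<phi> x)\<close>, or one of them hits \<open>L x\<close> and the others hit \<open>g (\<phi> x)\<close>. The error of the linear
  approximation of this \<open>n\<close>-th derivative is therefore a combination of two errors that do not involve the
  directions, those of \<open>g n (\<phi> x) *\<^sub>R L x\<close> and of \<open>g (n - 1) (\<phi> x)\<close>, with coefficients bounded by the
  product of the norms of the directions.
\<close>

lemma smooth_on_scaleR_functional:
  fixes \<phi> :: "'a::real_normed_vector \<Rightarrow> real" and L :: "'a \<Rightarrow> 'b::real_normed_vector"
  assumes \<phi>: "bounded_linear \<phi>" and L: "bounded_linear L" and U: "open U"
    and g: "\<And>n x. x \<in> U \<Longrightarrow> (g n has_real_derivative g (Suc n) (\<phi> x)) (at (\<phi> x))"
  shows "smooth_on U (\<lambda>x. g 0 (\<phi> x) *\<^sub>R L x)"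
proof -
  interpret \<phi>: bounded_linear \<phi> by (rule \<phi>)
  interpret L: bounded_linear L by (rule L)
  \<comment> \<open>For \<open>n = 0\<close> the truncated index \<open>n - 1\<close> is harmless, as \<open>leibniz_sum\<close> of the empty list is \<open>0\<close>.\<close>
  define D where "D n x vs =
    (g n (\<phi> x) * prod_list (map \<phi> vs)) *\<^sub>R L x + g (n - 1) (\<phi> x) *\<^sub>R leibniz_sum \<phi> L vs" for n x vs
  have mult: "bounded_multilinear n (D n x)" for n x
    unfolding bounded_multilinear_def
  proof (intro conjI allI impI)
    fix us v w r ws
    show "D n x (us @ (v + r *\<^sub>R w) # ws) = D n x (us @ v # ws) + r *\<^sub>R D n x (us @ w # ws)"
      by (simp add: D_def leibniz_sum_append \<phi>.add \<phi>.scaleR L.add L.scaleR algebra_simps)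
  next
    obtain P where P: "P \<ge> 0" "\<And>vs. length vs = n \<Longrightarrow> \<bar>prod_list (map \<phi> vs)\<bar> \<le> P * prod_list (map norm vs)"
      using prod_list_map_bounded[OF \<phi>, of n] by blast
    obtain C where C: "C \<ge> 0" "\<And>vs. length vs = n \<Longrightarrow> norm (leibniz_sum \<phi> L vs) \<le> C * prod_list (map norm vs)"
      using leibniz_sum_bounded[OF \<phi> L, of n] by blast
    have "norm (D n x vs) \<le> (\<bar>g n (\<phi> x)\<bar> * P * norm (L x) + \<bar>g (n - 1) (\<phi> x)\<bar> * C) * prod_list (map norm vs)"
      if "length vs = n" for vs
    proof -
      have "norm (D n x vs) \<le> \<bar>g n (\<phi> x)\<bar> * \<bar>prod_list (map \<phi> vs)\<bar> * norm (L x)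
          + \<bar>g (n - 1) (\<phi> x)\<bar> * norm (leibniz_sum \<phi> L vs)"
        unfolding D_def by (rule norm_triangle_le) (simp add: abs_mult)
      also have "\<dots> \<le> \<bar>g n (\<phi> x)\<bar> * (P * prod_list (map norm vs)) * norm (L x)
          + \<bar>g (n - 1) (\<phi> x)\<bar> * (C * prod_list (map norm vs))"
        using P C that by (intro add_mono mult_mono mult_nonneg_nonneg prod_list_norm_nonneg) auto
      finally show ?thesis by (simp add: algebra_simps)
    qed
    then show "\<exists>B. \<forall>vs. length vs = n \<longrightarrow> norm (D n x vs) \<le> B * prod_list (map norm vs)" by blast
  qed
  have diff: "multilinear_derivative n U x (D n) (D (Suc n) x)" if x: "x \<in> U" for n x
    unfolding multilinear_derivative_def
  proof (intro allI impI)
    fix \<epsilon> :: real assume \<epsilon>: "\<epsilon> > 0"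
    obtain P where P: "P \<ge> 0" "\<And>vs. length vs = n \<Longrightarrow> \<bar>prod_list (map \<phi> vs)\<bar> \<le> P * prod_list (map norm vs)"
      using prod_list_map_bounded[OF \<phi>, of n] by blast
    obtain C where C: "C \<ge> 0" "\<And>vs. length vs = n \<Longrightarrow> norm (leibniz_sum \<phi> L vs) \<le> C * prod_list (map norm vs)"
      using leibniz_sum_bounded[OF \<phi> L, of n] by blast
    define \<eta> where "\<eta> = \<epsilon> / (P + C + 1)"
    have \<eta>: "\<eta> > 0" using \<epsilon> P(1) C(1) by (simp add: \<eta>_def)
    have g': "((\<lambda>x. g k (\<phi> x)) has_derivative (\<lambda>h. g (Suc k) (\<phi> x) * \<phi> h)) (at x)" for k
      using has_derivative_compose[OF \<phi>.has_derivative[OF has_derivative_ident]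
          g[OF x, of k, unfolded has_field_derivative_def]] by (simp add: o_def)
    have "((\<lambda>x. g n (\<phi> x) *\<^sub>R L x) has_derivative
        (\<lambda>h. g n (\<phi> x) *\<^sub>R L h + (g (Suc n) (\<phi> x) * \<phi> h) *\<^sub>R L x)) (at x)"
      by (rule has_derivative_scaleR[OF g' L.has_derivative[OF has_derivative_ident]])
    then obtain d1 where d1: "d1 > 0" "\<And>y. norm (y - x) < d1 \<Longrightarrow>
        norm (g n (\<phi> y) *\<^sub>R L y - g n (\<phi> x) *\<^sub>R L x
          - (g n (\<phi> x) *\<^sub>R L (y - x) + (g (Suc n) (\<phi> x) * \<phi> (y - x)) *\<^sub>R L x)) \<le> \<eta> * norm (y - x)"
      using \<eta> unfolding has_derivative_at_alt by blast
    obtain d2 where d2: "d2 > 0" "\<And>y. norm (y - x) < d2 \<Longrightarrow>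
        norm (g (n - 1) (\<phi> y) - g (n - 1) (\<phi> x) - g (Suc (n - 1)) (\<phi> x) * \<phi> (y - x)) \<le> \<eta> * norm (y - x)"
      using g'[of "n - 1"] \<eta> unfolding has_derivative_at_alt by blast
    show "\<exists>\<delta>>0. \<forall>y\<in>U. norm (y - x) < \<delta> \<longrightarrow> (\<forall>vs. length vs = n \<longrightarrow>
        norm (D n y vs - D n x vs - D (Suc n) x ((y - x) # vs))
          \<le> \<epsilon> * norm (y - x) * prod_list (map norm vs))"
    proof (intro exI[of _ "min d1 d2"] conjI ballI impI allI)
      show "0 < min d1 d2" using d1(1) d2(1) by simp
      fix y and vs :: "'a list" assume y: "norm (y - x) < min d1 d2" and len: "length vs = n"
      let ?A = "g n (\<phi> y) *\<^sub>R L y - g n (\<phi> x) *\<^sub>R L x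
          - (g n (\<phi> x) *\<^sub>R L (y - x) + (g (Suc n) (\<phi> x) * \<phi> (y - x)) *\<^sub>R L x)"
      let ?B = "g (n - 1) (\<phi> y) - g (n - 1) (\<phi> x) - g (Suc (n - 1)) (\<phi> x) * \<phi> (y - x)"
      let ?N = "prod_list (map norm vs)"
      \<comment> \<open>\<open>n\<close> and \<open>Suc (n - 1)\<close> differ only for \<open>n = 0\<close>, where the sum vanishes.\<close>
      have S: "g n (\<phi> x) *\<^sub>R leibniz_sum \<phi> L vs = g (Suc (n - 1)) (\<phi> x) *\<^sub>R leibniz_sum \<phi> L vs"
        using len by (cases n) auto
      have "D (Suc n) x ((y - x) # vs) =
          (g (Suc n) (\<phi> x) * (\<phi> (y - x) * prod_list (map \<phi> vs))) *\<^sub>R L x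
          + (g n (\<phi> x) * prod_list (map \<phi> vs)) *\<^sub>R L (y - x)
          + \<phi> (y - x) *\<^sub>R (g (Suc (n - 1)) (\<phi> x) *\<^sub>R leibniz_sum \<phi> L vs)"
        unfolding S[symmetric] by (simp add: D_def scaleR_add_right mult_ac)
      then have "D n y vs - D n x vs - D (Suc n) x ((y - x) # vs)
          = prod_list (map \<phi> vs) *\<^sub>R ?A + ?B *\<^sub>R leibniz_sum \<phi> L vs"
        by (simp add: D_def scaleR_add_right scaleR_diff_right scaleR_diff_left mult_ac)
      then have "norm (D n y vs - D n x vs - D (Suc n) x ((y - x) # vs))
          \<le> \<bar>prod_list (map \<phi> vs)\<bar> * norm ?A + \<bar>?B\<bar> * norm (leibniz_sum \<phi> L vs)"
        by (metis norm_scaleR norm_triangle_ineq)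
      also have "\<dots> \<le> (P * ?N) * (\<eta> * norm (y - x)) + (\<eta> * norm (y - x)) * (C * ?N)"
        using P C len d1(2)[of y] d2(2)[of y] y \<eta> prod_list_norm_nonneg[of vs]
        by (intro add_mono mult_mono) auto
      also have "\<dots> = ((P + C) * \<eta>) * (norm (y - x) * ?N)" by (simp add: algebra_simps)
      also have "\<dots> \<le> \<epsilon> * (norm (y - x) * ?N)"
        using \<epsilon> P(1) C(1) prod_list_norm_nonneg[of vs]
        by (intro mult_right_mono mult_nonneg_nonneg) (auto simp: \<eta>_def field_simps)
      finally show "norm (D n y vs - D n x vs - D (Suc n) x ((y - x) # vs))
          \<le> \<epsilon> * norm (y - x) * ?N" by (simp add: mult.assoc)
    qed
  qed
  show ?thesis unfolding smooth_on_iff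
    by (intro conjI U exI[of _ D]) (use mult diff in \<open>auto simp: D_def\<close>)
qed

lemma smooth_on_bounded_linear:
  assumes "bounded_linear L" "open U"
  shows "smooth_on U L"
proof -
  have "smooth_on U (\<lambda>x. (\<lambda>n t. if n = 0 then 1 else 0) (0::nat) ((\<lambda>_. 0::real) x) *\<^sub>R L x)"
    by (rule smooth_on_scaleR_functional[OF bounded_linear_zero assms]) auto
  then show ?thesis by simp
qed

lemma bounded_multilinear_add:
  assumes M: "bounded_multilinear n M" and N: "bounded_multilinear n N"
  shows "bounded_multilinear n (\<lambda>vs. M vs + N vs)"
proof -
  obtain B where B: "\<And>vs. length vs = n \<Longrightarrow> norm (M vs) \<le> B * prod_list (map norm vs)"
    using M unfolding bounded_multilinear_def by blast
  obtain C where C: "\<And>vs. length vs = n \<Longrightarrow> norm (N vs) \<le> C * prod_list (map norm vs)"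
    using N unfolding bounded_multilinear_def by blast
  have "norm (M vs + N vs) \<le> (B + C) * prod_list (map norm vs)" if "length vs = n" for vs
    using norm_triangle_mono[OF B C] that by (simp add: algebra_simps)
  then have "\<exists>B. \<forall>vs. length vs = n \<longrightarrow> norm (M vs + N vs) \<le> B * prod_list (map norm vs)" by blast
  then show ?thesis using M N unfolding bounded_multilinear_def by (simp add: scaleR_add_right)
qed

lemma multilinear_derivative_add:
  fixes M N :: "'a::real_normed_vector \<Rightarrow> 'a list \<Rightarrow> 'b::real_normed_vector"
  assumes M: "multilinear_derivative n U x M M'" and N: "multilinear_derivative n U x N N'"
  shows "multilinear_derivative n U x (\<lambda>x vs. M x vs + N x vs) (\<lambda>vs. M' vs + N' vs)"
  unfolding multilinear_derivative_def
proof (intro allI impI)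
  fix \<epsilon> :: real assume \<epsilon>: "\<epsilon> > 0"
  obtain d where d: "d > 0" "\<And>y vs. y \<in> U \<Longrightarrow> norm (y - x) < d \<Longrightarrow> length vs = n \<Longrightarrow>
      norm (M y vs - M x vs - M' ((y - x) # vs)) \<le> \<epsilon> / 2 * norm (y - x) * prod_list (map norm vs)"
    using M half_gt_zero[OF \<epsilon>] unfolding multilinear_derivative_def by blast
  obtain e where e: "e > 0" "\<And>y vs. y \<in> U \<Longrightarrow> norm (y - x) < e \<Longrightarrow> length vs = n \<Longrightarrow>
      norm (N y vs - N x vs - N' ((y - x) # vs)) \<le> \<epsilon> / 2 * norm (y - x) * prod_list (map norm vs)"
    using N half_gt_zero[OF \<epsilon>] unfolding multilinear_derivative_def by blast
  show "\<exists>\<delta>>0. \<forall>y\<in>U. norm (y - x) < \<delta> \<longrightarrow> (\<forall>vs. length vs = n \<longrightarrow>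
      norm (M y vs + N y vs - (M x vs + N x vs) - (M' ((y - x) # vs) + N' ((y - x) # vs)))
        \<le> \<epsilon> * norm (y - x) * prod_list (map norm vs))"
  proof (intro exI[of _ "min d e"] conjI ballI impI allI)
    show "0 < min d e" using d(1) e(1) by simp
    fix y and vs :: "'a list" assume y: "y \<in> U" "norm (y - x) < min d e" and len: "length vs = n"
    have "norm ((M y vs - M x vs - M' ((y - x) # vs)) + (N y vs - N x vs - N' ((y - x) # vs)))
      \<le> \<epsilon> / 2 * norm (y - x) * prod_list (map norm vs) + \<epsilon> / 2 * norm (y - x) * prod_list (map norm vs)"
      using y len by (intro norm_triangle_mono d e) auto
    then show "norm (M y vs + N y vs - (M x vs + N x vs) - (M' ((y - x) # vs) + N' ((y - x) # vs)))
        \<le> \<epsilon> * norm (y - x) * prod_list (map norm vs)"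
      by (simp add: algebra_simps)
  qed
qed

lemma smooth_on_add:
  assumes f: "smooth_on U f" and h: "smooth_on U h"
  shows "smooth_on U (\<lambda>x. f x + h x)"
proof -
  obtain D where D: "\<forall>x\<in>U. D 0 x [] = f x" "\<forall>n. \<forall>x\<in>U. bounded_multilinear n (D n x)"
    "\<forall>n. \<forall>x\<in>U. multilinear_derivative n U x (D n) (D (Suc n) x)"
    using f unfolding smooth_on_iff by auto
  obtain E where E: "\<forall>x\<in>U. E 0 x [] = h x" "\<forall>n. \<forall>x\<in>U. bounded_multilinear n (E n x)"
    "\<forall>n. \<forall>x\<in>U. multilinear_derivative n U x (E n) (E (Suc n) x)"
    using h unfolding smooth_on_iff by auto
  have "open U" using f by (simp add: smooth_on_iff)
  then show ?thesis unfolding smooth_on_iff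
    by (intro conjI exI[of _ "\<lambda>n x vs. D n x vs + E n x vs"])
      (use D E in \<open>auto intro: bounded_multilinear_add multilinear_derivative_add\<close>)
qed

lemma smooth_on_scaleR_inverse_functional:
  assumes "bounded_linear \<phi>" "bounded_linear L" "open U" "\<And>x. x \<in> U \<Longrightarrow> \<phi> x \<noteq> 0"
  shows "smooth_on U (\<lambda>x. (1 / \<phi> x) *\<^sub>R L x)"
proof -
  define g :: "nat \<Rightarrow> real \<Rightarrow> real" where "g n t = (-1) ^ n * fact n / t ^ Suc n" for n t
  have g: "(g n has_real_derivative g (Suc n) t) (at t)" if t: "t \<noteq> 0" for n t
  proof -
    have "(g n has_real_derivative
        (0 * t ^ Suc n - (-1) ^ n * fact n * (real (Suc n) * t ^ n)) / (t ^ Suc n * t ^ Suc n)) (at t)"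
      unfolding g_def using t by (intro DERIV_divide DERIV_const) (use DERIV_pow[of "Suc n" t UNIV] in auto)
    moreover have "(0 * t ^ Suc n - (-1) ^ n * fact n * (real (Suc n) * t ^ n)) / (t ^ Suc n * t ^ Suc n)
        = g (Suc n) t"
      using t by (simp add: g_def divide_simps)
    ultimately show ?thesis by simp
  qed
  have "smooth_on U (\<lambda>x. g 0 (\<phi> x) *\<^sub>R L x)"
    by (rule smooth_on_scaleR_functional[OF assms(1-3)]) (use g assms(4) in auto)
  then show ?thesis by (simp add: g_def)
qed

lemma smooth_on_scaleR_bounded_linear:
  assumes "bounded_linear \<phi>" "bounded_linear L" "open U"
  shows "smooth_on U (\<lambda>x. \<phi> x *\<^sub>R L x)"
proof -
  define g :: "nat \<Rightarrow> real \<Rightarrow> real" where "g n t = (if n = 0 then t else if n = 1 then 1 else 0)" for n t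
  have g: "(g n has_real_derivative g (Suc n) t) (at t)" for n t
    by (cases n) (auto simp: g_def[abs_def])
  have "smooth_on U (\<lambda>x. g 0 (\<phi> x) *\<^sub>R L x)"
    by (rule smooth_on_scaleR_functional[OF assms]) (rule g)
  then show ?thesis by (simp add: g_def)
qed

section \<open>The scalar as a positive linear functional\<close>

lemma op_of_scal_decomp:
  obtains a where "a \<in> HSh" "op_of x = a + scal x *\<^sub>R id_blinfun"
proof (rule op_of_cases[of x])
  fix a r assume a: "a \<in> HSh" "op_of x = a + scalar_op (complex_of_real r)"
  then have "scal x = r" by (simp add: scal_def scalar_part_eq HSh_def)
  then show thesis using a that by (simp add: scalar_op_of_real)
qed

lemma scal_unique:
  assumes "a \<in> HSh" "op_of x = a + r *\<^sub>R id_blinfun" shows "scal x = r"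
  using scal_eq[OF assms(1), of r] assms(2) by (metis op_of_inverse)

lemma scal_eq_inner: "scal x = inner x 1"
proof (rule op_of_scal_decomp[of x])
  fix a assume a: "a \<in> HSh" "op_of x = a + scal x *\<^sub>R id_blinfun"
  have "op_of (1::'a hr) = 0 + scalar_op (complex_of_real 1)" by (simp add: op_of_one scalar_op_of_real del: of_real_1)
  from inner_hr_eq[OF a(1) _ HSh_0 this, of x "scal x"] a(2) show ?thesis by (simp add: scalar_op_of_real)
qed

lemma bounded_linear_scal: "bounded_linear scal"
  unfolding scal_eq_inner[abs_def] by (rule bounded_linear_inner_left)

lemma scal_scaleR [simp]: "scal (r *\<^sub>R x) = r * scal x"
  by (simp add: scal_eq_inner)

lemma scal_add: "scal (x + y) = scal x + scal y"
  by (simp add: scal_eq_inner inner_add_left)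

lemma scal_diff: "scal (x - y) = scal x - scal y"
  by (simp add: scal_eq_inner inner_diff_left)

lemma scal_one [simp]: "scal 1 = 1"
  using scal_unique[OF HSh_0, of 1 1] by (simp add: op_of_one)

lemma op_of_in_HSh_iff: "op_of x \<in> HSh \<longleftrightarrow> scal x = 0"
proof (rule op_of_scal_decomp[of x])
  fix a assume a: "a \<in> HSh" "op_of x = a + scal x *\<^sub>R id_blinfun"
  then show ?thesis using scal_unique[of "op_of x" x 0] by auto
qed

lemma onb_norm: "onb E \<Longrightarrow> e \<in> E \<Longrightarrow> norm e = 1"
proof -
  assume "onb E" "e \<in> E"
  then have "complex_of_real ((norm e)\<^sup>2) = 1" unfolding cinner_self[symmetric] by (simp add: onb_def)
  then have "(norm e)\<^sup>2 = 1" by (simp only: of_real_eq_1_iff)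
  then show ?thesis using norm_ge_zero[of e] by (auto simp: power2_eq_1_iff)
qed

text \<open>
  Square summability over a basis, which is infinite, forces arbitrarily small values.
\<close>

lemma HS_not_bounded_below_on_onb:
  assumes a: "a \<in> HS" and E: "onb E" and c: "c > 0"
  shows "\<exists>e\<in>E. norm (blinfun_apply a e) < c"
proof (rule ccontr)
  assume "\<not> ?thesis"
  then have ge: "c \<le> norm (a e)" if "e \<in> E" for e using that by force
  have "(\<lambda>e. (norm (a e))\<^sup>2) summable_on E" using a E by (auto simp: HS_def)
  then have "(\<lambda>e. c\<^sup>2) summable_on E"
    by (rule summable_on_comparison_test) (use ge c in \<open>auto intro: power_mono\<close>)
  then show False using infsum_diverge_constant[of E "c\<^sup>2"] c infinite_onb[OF E] by auto
qed

text \<open>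
  If \<open>\<lambda> = 0\<close>, then \<open>a\<close> itself is invertible and \<open>norm (a e) \<ge> 1 / norm a\<^sup>-\<^sup>1\<close>. If \<open>\<lambda> < 0\<close>, then positivity
  of \<open>a + \<lambda>\<close> gives \<open>norm (a e) \<ge> Re (cinner (a e) e) \<ge> - \<lambda>\<close>. Either way \<open>a\<close> is bounded below on a basis.
\<close>

lemma scal_pos:
  assumes "p \<in> Sigma_pos" shows "scal p > 0"
proof (rule ccontr)
  assume neg: "\<not> scal p > 0"
  obtain a where a: "a \<in> HSh" "op_of p = a + scal p *\<^sub>R id_blinfun" by (rule op_of_scal_decomp)
  have E: "onb some_onb" by (rule onb_some_onb)
  note n = onb_norm[OF onb_some_onb]
  have "\<exists>c>0. \<forall>e\<in>some_onb. c \<le> norm (a e)"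
  proof (cases "scal p = 0")
    case True
    obtain B where B: "B o\<^sub>L op_of p = id_blinfun"
      using assms by (auto simp: Sigma_pos_def invertible_op_def)
    \<comment> \<open>Adding \<open>1\<close> to the norm keeps the denominator positive without showing \<open>B \<noteq> 0\<close>.\<close>
    have "1 / (norm B + 1) \<le> norm (a e)" if "e \<in> some_onb" for e
    proof -
      have "B (a e) = e" using arg_cong[OF B, of "\<lambda>f. blinfun_apply f e"] a(2) True by simp
      then have "1 \<le> norm B * norm (a e)" using norm_blinfun[of B "a e"] n[OF that] by simp
      also have "\<dots> \<le> (norm B + 1) * norm (a e)" by (intro mult_right_mono) auto
      finally have "1 \<le> (norm B + 1) * norm (a e)" .
      moreover have "0 < norm B + 1" using norm_ge_zero[of B] by linarith
      ultimately show ?thesis by (simp only: pos_divide_le_eq mult.commute)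
    qed
    then show ?thesis using norm_ge_zero[of B] by (intro exI[of _ "1 / (norm B + 1)"]) (auto simp: add_nonneg_pos)
  next
    case False
    have "- scal p \<le> norm (a e)" if "e \<in> some_onb" for e
    proof -
      have "0 \<le> Re (cinner (op_of p e) e)" using assms by (simp add: Sigma_pos_def positive_op_def)
      also have "\<dots> = Re (cinner (a e) e) + scal p"
        by (simp add: a(2) blinfun.add_left blinfun.scaleR_left cinner_add_left cinner_scaleR_left
            cinner_self n[OF that])
      also have "Re (cinner (a e) e) \<le> norm (a e)"
        using complex_Re_le_cmod[of "cinner (a e) e"] cinner_bound[of "a e" e] n[OF that] by simp
      finally show ?thesis by simp
    qed
    then show ?thesis using neg False by (intro exI[of _ "- scal p"]) auto
  qed
  then show False using HS_not_bounded_below_on_onb[OF _ E] a(1) by (fastforce simp: HSh_def)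
qed

section \<open>Inverses and the metric\<close>

lemma blinfun_compose_id [simp]: "A o\<^sub>L id_blinfun = A" "id_blinfun o\<^sub>L A = A"
  by (auto intro!: blinfun_eqI)

lemmas blinfun_compose_add_right = bounded_bilinear.add_right[OF bounded_bilinear_blinfun_compose]
  and blinfun_compose_diff_left = bounded_bilinear.diff_left[OF bounded_bilinear_blinfun_compose]
  and blinfun_compose_diff_right = bounded_bilinear.diff_right[OF bounded_bilinear_blinfun_compose]
  and blinfun_compose_scaleR_left = bounded_bilinear.scaleR_left[OF bounded_bilinear_blinfun_compose]
  and blinfun_compose_scaleR_right = bounded_bilinear.scaleR_right[OF bounded_bilinear_blinfun_compose]

lemma blinfun_compose_assoc: "(A o\<^sub>L B) o\<^sub>L C = A o\<^sub>L (B o\<^sub>L C)"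
  by (rule blinfun_eqI) simp

lemma inv_op_eqI:
  assumes "A o\<^sub>L B = id_blinfun" "B o\<^sub>L A = id_blinfun" shows "inv_op A = B"
  unfolding inv_op_def
proof (rule the_equality)
  fix C assume "A o\<^sub>L C = id_blinfun \<and> C o\<^sub>L A = id_blinfun"
  then have "C = (B o\<^sub>L A) o\<^sub>L C" "B o\<^sub>L (A o\<^sub>L C) = B" using assms by (auto intro!: blinfun_eqI)
  then show "C = B" by (simp add: blinfun_compose_assoc)
qed (use assms in simp)

lemma inv_op_compose:
  assumes "invertible_op A" shows "A o\<^sub>L inv_op A = id_blinfun" "inv_op A o\<^sub>L A = id_blinfun"
  using assms inv_op_eqI unfolding invertible_op_def by metis+

lemma inv_op_scaleR:
  assumes A: "invertible_op A" and r: "r \<noteq> 0"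
  shows "inv_op (r *\<^sub>R A) = (1 / r) *\<^sub>R inv_op A" "invertible_op (r *\<^sub>R A)"
proof -
  have *: "(r *\<^sub>R A) o\<^sub>L ((1 / r) *\<^sub>R inv_op A) = id_blinfun"
    "((1 / r) *\<^sub>R inv_op A) o\<^sub>L (r *\<^sub>R A) = id_blinfun"
    using inv_op_compose[OF A] r
    by (simp_all add: blinfun_compose_scaleR_left blinfun_compose_scaleR_right)
  then show "inv_op (r *\<^sub>R A) = (1 / r) *\<^sub>R inv_op A" by (rule inv_op_eqI)
  show "invertible_op (r *\<^sub>R A)" using * unfolding invertible_op_def by blast
qed

lemma HS_compose_left:
  assumes B: "clinear_op B" and A: "A \<in> HS" shows "B o\<^sub>L A \<in> HS"
proof -
  have "(\<lambda>e. (norm ((B o\<^sub>L A) e))\<^sup>2) summable_on E" if E: "onb E" for E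
  proof (rule summable_on_comparison_test)
    show "(\<lambda>e. (norm B)\<^sup>2 * (norm (A e))\<^sup>2) summable_on E"
      using A E by (intro summable_on_cmult_right) (auto simp: HS_def)
    show "(norm ((B o\<^sub>L A) e))\<^sup>2 \<le> (norm B)\<^sup>2 * (norm (A e))\<^sup>2" for e
      using power_mono[OF norm_blinfun[of B "A e"], of 2] by (simp add: power_mult_distrib)
  qed auto
  then show ?thesis using A B by (auto simp: HS_def clinear_op_def)
qed

lemma clinear_op_of: "clinear_op (op_of x)"
proof (rule op_of_scal_decomp[of x])
  fix a assume a: "a \<in> HSh" "op_of x = a + scal x *\<^sub>R id_blinfun"
  then show ?thesis by (auto simp: HSh_def HS_def clinear_op_def blinfun.add_left blinfun.scaleR_left
        scaleC_add_right scaleR_scaleC scaleC_scaleC mult.commute)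
qed

lemma clinear_inv_op:
  assumes A: "invertible_op A" "clinear_op A" shows "clinear_op (inv_op A)"
  unfolding clinear_op_def
proof (intro allI)
  fix c x
  have 1: "A (inv_op A y) = y" "inv_op A (A y) = y" for y
    using inv_op_compose[OF A(1)] by (metis blinfun_apply_blinfun_compose blinfun_apply_id_blinfun id_apply)+
  have "A (c *\<^sub>C inv_op A x) = c *\<^sub>C x" using A(2) 1 by (simp add: clinear_op_def)
  then show "inv_op A (c *\<^sub>C x) = c *\<^sub>C inv_op A x" using 1(2) by metis
qed

lemma clinear_op_compose: "clinear_op A \<Longrightarrow> clinear_op B \<Longrightarrow> clinear_op (A o\<^sub>L B)"
  by (simp add: clinear_op_def)

text \<open>
  Substituting \<open>P\<^sup>-\<^sup>1 = (1 - P\<^sup>-\<^sup>1 a) / \<lambda>\<close> in \<open>V P\<^sup>-\<^sup>1\<close> leaves \<open>(V - (V P\<^sup>-\<^sup>1) a) / \<lambda>\<close>, where the Hilbert-Schmidt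
  factor \<open>a\<close> stands on the right. For \<open>P\<^sup>-\<^sup>1 V\<close> only the multiple \<open>\<xi> P\<^sup>-\<^sup>1\<close> is expanded, with the
  same effect. In both cases the remainder is Hilbert-Schmidt because these operators form a left ideal.
\<close>

lemma HS_minus_scalar_compose_inv:
  assumes p: "invertible_op (op_of p)" and s: "scal p \<noteq> 0"
  shows "(op_of v o\<^sub>L inv_op (op_of p)) - (scal v / scal p) *\<^sub>R id_blinfun \<in> HS" (is ?right)
    and "(inv_op (op_of p) o\<^sub>L op_of v) - (scal v / scal p) *\<^sub>R id_blinfun \<in> HS" (is ?left)
proof -
  let ?V = "op_of v" and ?P = "op_of p" and ?Q = "inv_op (op_of p)"
  obtain a where a: "a \<in> HSh" "?P = a + scal p *\<^sub>R id_blinfun" by (rule op_of_scal_decomp)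
  obtain b where b: "b \<in> HSh" "?V = b + scal v *\<^sub>R id_blinfun" by (rule op_of_scal_decomp)
  have HS: "a \<in> HS" "b \<in> HS" using a b by (auto simp: HSh_def)
  have cl: "clinear_op ?Q" "clinear_op (?V o\<^sub>L ?Q)"
    using clinear_inv_op[OF p] clinear_op_of clinear_op_compose by blast+
  have "id_blinfun = (?Q o\<^sub>L a) + scal p *\<^sub>R ?Q"
    using inv_op_compose(2)[OF p] a(2)
    by (simp add: blinfun_compose_add_right blinfun_compose_scaleR_right)
  then have "(1 / scal p) *\<^sub>R (id_blinfun - (?Q o\<^sub>L a)) = (1 / scal p) *\<^sub>R (scal p *\<^sub>R ?Q)"
    by (metis add_diff_cancel_left')
  then have Q: "?Q = (1 / scal p) *\<^sub>R (id_blinfun - (?Q o\<^sub>L a))" using s by simp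
  have "?V o\<^sub>L ?Q = (1 / scal p) *\<^sub>R (?V - ((?V o\<^sub>L ?Q) o\<^sub>L a))"
    by (subst Q) (simp add: blinfun_compose_scaleR_right blinfun_compose_diff_right blinfun_compose_assoc)
  then have "(?V o\<^sub>L ?Q) - (scal v / scal p) *\<^sub>R id_blinfun
      = (1 / scal p) *\<^sub>R (b - ((?V o\<^sub>L ?Q) o\<^sub>L a))"
    by (simp add: b(2) algebra_simps)
  then show ?right using HS HS_compose_left[OF cl(2) HS(1)] by (simp add: HS_scaleR HS_diff)
  have "?Q o\<^sub>L ?V = (?Q o\<^sub>L b) + scal v *\<^sub>R ?Q"
    by (simp add: b(2) blinfun_compose_add_right blinfun_compose_scaleR_right)
  also have "scal v *\<^sub>R ?Q = (scal v / scal p) *\<^sub>R (id_blinfun - (?Q o\<^sub>L a))"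
    by (subst Q) simp
  finally have "(?Q o\<^sub>L ?V) - (scal v / scal p) *\<^sub>R id_blinfun
      = (?Q o\<^sub>L b) - (scal v / scal p) *\<^sub>R (?Q o\<^sub>L a)"
    by (simp add: algebra_simps)
  then show ?left using HS_compose_left[OF cl(1)] HS by (simp add: HS_scaleR HS_diff)
qed

text \<open>
  Hilbert-Schmidt operators and scalars are orthogonal: removing the scalar parts removes exactly their product.
\<close>

lemma ip2_scalar_shift:
  assumes "A - r *\<^sub>R id_blinfun \<in> HS" "B - s *\<^sub>R id_blinfun \<in> HS"
  shows "ip2 A B = ip2 (A - r *\<^sub>R id_blinfun) (B - s *\<^sub>R id_blinfun) + of_real (r * s)"
proof -
  have "scalar_part A = of_real r \<and> hs_part A = A - r *\<^sub>R id_blinfun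
      \<and> scalar_part (A - r *\<^sub>R id_blinfun) = 0 \<and> hs_part (A - r *\<^sub>R id_blinfun) = A - r *\<^sub>R id_blinfun"
    if "A - r *\<^sub>R id_blinfun \<in> HS" for A :: "'a \<Rightarrow>\<^sub>L 'a" and r
    using scalar_part_eq[OF that, of "of_real r"] hs_part_eq[OF that, of "of_real r"]
      scalar_part_eq[OF that, of 0] hs_part_eq[OF that, of 0]
    by (simp add: scalar_op_of_real scalar_op_of_real[of 0, simplified])
  from this[OF assms(1)] this[OF assms(2)] show ?thesis by (simp add: ip2_def)
qed

lemma sigma_metric_Lambda:
  assumes "l \<noteq> 0"
  shows "sigma_metric (l *\<^sub>R 1) (r *\<^sub>R 1) (s *\<^sub>R 1) = (r / l) * (s / l)"
proof -
  have inv: "inv_op (l *\<^sub>R id_blinfun) = (1 / l) *\<^sub>R (id_blinfun :: 'a \<Rightarrow>\<^sub>L 'a)"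
    using assms by (intro inv_op_eqI) (auto intro!: blinfun_eqI simp: blinfun.scaleR_left blinfun.scaleR_right)
  have c: "(t *\<^sub>R id_blinfun) o\<^sub>L ((1 / l) *\<^sub>R id_blinfun) = (t / l) *\<^sub>R (id_blinfun :: 'a \<Rightarrow>\<^sub>L 'a)"
    "((1 / l) *\<^sub>R id_blinfun) o\<^sub>L (t *\<^sub>R id_blinfun) = (t / l) *\<^sub>R (id_blinfun :: 'a \<Rightarrow>\<^sub>L 'a)" for t
    by (auto intro!: blinfun_eqI simp: blinfun.scaleR_left blinfun.scaleR_right)
  have "sigma_metric (l *\<^sub>R 1) (r *\<^sub>R 1) (s *\<^sub>R 1 :: 'a hr) = inner ((r / l) *\<^sub>R (1 :: 'a hr)) ((s / l) *\<^sub>R 1)"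
    by (simp add: sigma_metric_def inner_hr_def op_of_scaleR op_of_one inv c)
  also have "\<dots> = (r / l) * (s / l) * scal (1 :: 'a hr)"
    by (simp add: scal_eq_inner del: scal_one)
  finally show ?thesis by simp
qed

text \<open>
  The first summand is evaluated at the point \<open>P / \<lambda>\<close>, whose inverse is \<open>\<lambda> P\<^sup>-\<^sup>1\<close>; multiplied by
  it, the first components of the derivative of \<open>T\<close> become the Hilbert-Schmidt parts of \<open>V P\<^sup>-\<^sup>1\<close> and
  \<open>P\<^sup>-\<^sup>1 W\<close>.
\<close>

lemma sigma_metric_split:
  assumes p: "p \<in> Sigma_pos"
  shows "sigma_metric ((1 / scal p) *\<^sub>R p)
          ((1 / scal p) *\<^sub>R v - (scal v / (scal p)\<^sup>2) *\<^sub>R p)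
          ((1 / scal p) *\<^sub>R w - (scal w / (scal p)\<^sup>2) *\<^sub>R p)
        + (scal v / scal p) * (scal w / scal p) = sigma_metric p v w"
proof -
  have s: "scal p \<noteq> 0" using scal_pos[OF p] by simp
  have inv: "invertible_op (op_of p)" using p by (simp add: Sigma_pos_def)
  note i = inv_op_compose[OF inv]
  have q: "inv_op (op_of ((1 / scal p) *\<^sub>R p)) = scal p *\<^sub>R inv_op (op_of p)"
    using inv_op_scaleR(1)[OF inv, of "1 / scal p"] s by (simp add: op_of_scaleR)
  have 1: "op_of ((1 / scal p) *\<^sub>R v - (scal v / (scal p)\<^sup>2) *\<^sub>R p) o\<^sub>L (scal p *\<^sub>R inv_op (op_of p))
      = (op_of v o\<^sub>L inv_op (op_of p)) - (scal v / scal p) *\<^sub>R id_blinfun" for v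
    using s by (simp add: op_of_minus op_of_scaleR blinfun_compose_diff_left blinfun_compose_scaleR_left
        blinfun_compose_scaleR_right i scaleR_diff_right power2_eq_square)
  have 2: "(scal p *\<^sub>R inv_op (op_of p)) o\<^sub>L op_of ((1 / scal p) *\<^sub>R v - (scal v / (scal p)\<^sup>2) *\<^sub>R p)
      = (inv_op (op_of p) o\<^sub>L op_of v) - (scal v / scal p) *\<^sub>R id_blinfun" for v
    using s by (simp add: op_of_minus op_of_scaleR blinfun_compose_diff_right blinfun_compose_scaleR_left
        blinfun_compose_scaleR_right i scaleR_diff_right power2_eq_square)
  show ?thesis unfolding sigma_metric_def q 1 2
    by (simp add: ip2_scalar_shift[OF HS_minus_scalar_compose_inv[OF inv s]])
qed

section \<open>The splitting map\<close>

lemma Sigma_pos_scaleR: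
  assumes "p \<in> Sigma_pos" "r > 0" shows "r *\<^sub>R p \<in> Sigma_pos"
  using assms inv_op_scaleR(2)[of "op_of p" r]
  by (auto simp: Sigma_pos_def positive_op_def selfadjoint_def op_of_scaleR blinfun.scaleR_left
      cinner_scaleR_left cinner_scaleR_right)

lemma Sigma_one_iff: "p \<in> Sigma_one \<longleftrightarrow> p \<in> Sigma_pos \<and> scal p = 1"
proof (rule op_of_scal_decomp[of p])
  fix a assume a: "a \<in> HSh" "op_of p = a + scal p *\<^sub>R id_blinfun"
  then show ?thesis using scal_unique[of _ p 1] by (auto simp: Sigma_one_def)
qed

lemma T_map_inverse:
  assumes "q \<in> Sigma_one" "l \<in> Lambda_pos"
  shows "scal l *\<^sub>R q \<in> Sigma_pos" "T_map (scal l *\<^sub>R q) = (q, l)"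
  using assms by (auto simp: Lambda_pos_def Sigma_one_iff Sigma_pos_scaleR T_map_def)

lemma T_map_bij:
  "bij_betw T_map (Sigma_pos :: 'h::infinite_separable_hilbert hr set) (Sigma_one \<times> Lambda_pos)"
proof (rule bij_betw_byWitness[where f' = "\<lambda>(q, l). scal l *\<^sub>R q"])
  show "\<forall>p\<in>Sigma_pos. (case T_map p of (q, l) \<Rightarrow> scal l *\<^sub>R q) = p"
    using scal_pos by (force simp: T_map_def)
  show "\<forall>x\<in>Sigma_one \<times> Lambda_pos. T_map (case x of (q, l) \<Rightarrow> scal l *\<^sub>R q) = x"
    using T_map_inverse by auto
  show "T_map ` Sigma_pos \<subseteq> Sigma_one \<times> Lambda_pos"
    using scal_pos by (force simp: T_map_def Sigma_one_iff Lambda_pos_def Sigma_pos_scaleR)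
  show "(\<lambda>(q, l). scal l *\<^sub>R q) ` (Sigma_one \<times> (Lambda_pos :: 'h hr set)) \<subseteq> (Sigma_pos :: 'h hr set)"
    using T_map_inverse by auto
qed

lemma smooth_T_map: "smooth_map Sigma_pos T_map"
proof -
  have o: "open {p. 0 < scal p}"
    using bounded_linear.continuous_on[OF bounded_linear_scal continuous_on_id, of UNIV]
    by (intro open_Collect_less) auto
  \<comment> \<open>\<open>T\<close> is smooth on this open half space, which contains \<open>Sigma_pos\<close>.\<close>
  have "smooth_on {p. 0 < scal p} (\<lambda>p. (1 / scal p) *\<^sub>R (p, 0) + (0, scal p *\<^sub>R 1))"
    by (intro smooth_on_add smooth_on_scaleR_inverse_functional smooth_on_bounded_linear
        bounded_linear_scal o bounded_linear_Pair bounded_linear_ident bounded_linear_zero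
        bounded_linear_scaleR_const bounded_linear_compose[OF bounded_linear_scaleR_left bounded_linear_scal]) auto
  then have "smooth_on {p. 0 < scal p} T_map" by (simp add: T_map_def[abs_def])
  then show ?thesis unfolding smooth_map_def
    by (intro ballI exI[of _ "{p. 0 < scal p}"] exI[of _ T_map]) (simp add: scal_pos)
qed

lemma smooth_inv_T_map: "smooth_map (Sigma_one \<times> Lambda_pos) (inv_into Sigma_pos T_map)"
proof -
  have "smooth_on UNIV (\<lambda>x::'a hr \<times> 'a hr. scal (snd x) *\<^sub>R fst x)"
    by (intro smooth_on_scaleR_bounded_linear bounded_linear_fst open_UNIV
        bounded_linear_compose[OF bounded_linear_scal bounded_linear_snd])
  moreover have "scal (snd x) *\<^sub>R fst x = inv_into Sigma_pos T_map x" if "x \<in> Sigma_one \<times> Lambda_pos" for x :: "'a hr \<times> 'a hr"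
    using that T_map_inverse[of "fst x" "snd x"] inv_into_f_f[OF bij_betw_imp_inj_on[OF T_map_bij]]
    by (metis mem_Times_iff prod.collapse)
  ultimately show ?thesis unfolding smooth_map_def
    by (intro ballI exI[of _ UNIV] exI[of _ "\<lambda>x. scal (snd x) *\<^sub>R fst x"]) simp
qed

lemma T_map_has_derivative:
  assumes "scal p \<noteq> 0"
  shows "(T_map has_derivative
      (\<lambda>v. ((1 / scal p) *\<^sub>R v - (scal v / (scal p)\<^sup>2) *\<^sub>R p, scal v *\<^sub>R 1))) (at p within M)"
proof -
  note scal = bounded_linear.has_derivative[OF bounded_linear_scal]
  have "((\<lambda>p. (1 / scal p) *\<^sub>R p) has_derivative
      (\<lambda>v. (1 / scal p) *\<^sub>R v + (- (scal v / (scal p)\<^sup>2)) *\<^sub>R p)) (at p within M)"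
    using has_derivative_scaleR[OF Deriv.has_derivative_inverse[OF assms scal[OF has_derivative_ident]]
        has_derivative_ident, of M]
    by (simp add: power2_eq_square divide_inverse mult_ac)
  moreover have "((\<lambda>p. scal p *\<^sub>R 1) has_derivative (\<lambda>v. scal v *\<^sub>R 1)) (at p within M)"
    by (rule has_derivative_scaleR_left[OF scal[OF has_derivative_ident]])
  ultimately show ?thesis unfolding T_map_def[abs_def]
    using has_derivative_Pair by fastforce
qed

text \<open>
  The inverse is the derivative of \<open>(q, l) \<mapsto> scal l *\<^sub>R q\<close> at \<open>T p\<close>.
\<close>

lemma bij_betw_derivative_T_map:
  fixes p q l :: "'h::infinite_separable_hilbert hr"
  assumes s: "scal p \<noteq> 0"
  shows "bij_betw (\<lambda>v. ((1 / scal p) *\<^sub>R v - (scal v / (scal p)\<^sup>2) *\<^sub>R p, scal v *\<^sub>R 1))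
      (tangent_Sigma p) (tangent_Sigma_one q \<times> tangent_Lambda l)"
proof (rule bij_betw_byWitness[where f' = "\<lambda>(x, y). scal p *\<^sub>R x + (scal y / scal p) *\<^sub>R p"])
  show "\<forall>v\<in>tangent_Sigma p. (case ((1 / scal p) *\<^sub>R v - (scal v / (scal p)\<^sup>2) *\<^sub>R p, scal v *\<^sub>R (1 :: 'h hr)) of
      (x, y) \<Rightarrow> scal p *\<^sub>R x + (scal y / scal p) *\<^sub>R p) = v"
    using s by (simp add: scaleR_diff_right power2_eq_square)
  show "\<forall>z\<in>tangent_Sigma_one q \<times> tangent_Lambda l.
      (\<lambda>v. ((1 / scal p) *\<^sub>R v - (scal v / (scal p)\<^sup>2) *\<^sub>R p, scal v *\<^sub>R 1))
        (case z of (x, y) \<Rightarrow> scal p *\<^sub>R x + (scal y / scal p) *\<^sub>R p) = z"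
    using s by (auto simp: tangent_Sigma_one_def tangent_Lambda_def op_of_in_HSh_iff scal_add
        scaleR_add_right power2_eq_square)
qed (use s in \<open>auto simp: tangent_Sigma_def tangent_Sigma_one_def tangent_Lambda_def op_of_in_HSh_iff
    scal_diff power2_eq_square\<close>)

theorem proposition7p4:
  shows "riemannian_isomorphism
      (Sigma_pos :: 'h::infinite_separable_hilbert hr set) tangent_Sigma sigma_metric
      (Sigma_one \<times> Lambda_pos)
      (\<lambda>(q, l). tangent_Sigma_one q \<times> tangent_Lambda l)
      (product_metric sigma_metric sigma_metric)
      T_map"
  unfolding riemannian_isomorphism_def
proof (rule conjI[OF T_map_bij conjI[OF smooth_T_map conjI[OF smooth_inv_T_map ballI]]])
  fix p :: "'h hr" assume p: "p \<in> Sigma_pos"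
  have s: "scal p \<noteq> 0" using scal_pos[OF p] by simp
  let ?D = "\<lambda>v. ((1 / scal p) *\<^sub>R v - (scal v / (scal p)\<^sup>2) *\<^sub>R p, scal v *\<^sub>R (1 :: 'h hr))"
  have "bij_betw ?D (tangent_Sigma p) ((\<lambda>(q, l). tangent_Sigma_one q \<times> tangent_Lambda l) (T_map p))"
    using bij_betw_derivative_T_map[OF s] by (simp add: T_map_def)
  moreover have "product_metric sigma_metric sigma_metric (T_map p) (?D v) (?D w) = sigma_metric p v w" for v w
    using sigma_metric_split[OF p, of v w] sigma_metric_Lambda[OF s, of "scal v" "scal w", where 'a = 'h]
    by (simp add: product_metric_def T_map_def)
  ultimately show "\<exists>D. (T_map has_derivative D) (at p within Sigma_pos) \<and>
      bij_betw D (tangent_Sigma p) ((\<lambda>(q, l). tangent_Sigma_one q \<times> tangent_Lambda l) (T_map p)) \<and>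
      (\<forall>v\<in>tangent_Sigma p. \<forall>w\<in>tangent_Sigma p.
          product_metric sigma_metric sigma_metric (T_map p) (D v) (D w) = sigma_metric p v w)"
    using T_map_has_derivative[OF s] by (intro exI[of _ ?D] conjI ballI)
qed

end
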